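(* There exists a rotational Steiner quadruple system on $92$ points, i.e.\ a Steiner system $S(3,4,92)$ admitting an automorphism that fixes one point and permutes the remaining $91$ points in a single cycle of length $91$.
   Context: A Steiner system $S(t,k,v)$ is a pair $(X,\mathcal{B})$ where $X$ is a set of $v$ points and $\mathcal{B}$ is a family of $k$-element subsets of $X$ (blocks) such that every $t$-subset of $X$ is contained in exactly one block. A Steiner quadruple system $\mathrm{SQS}(v)$ is an $S(3,4,v)$. It is called rotational, written $\mathrm{RoSQS}(v)$, if it has an automorphism (a permutation of $X$ mapping blocks to blocks) that fixes one point and acts as a single cycle of length $v-1$ on the remaining points. *)

theory Defs
  imports "HOL-Combinatorics.Orbits"
begin

definition steiner_system :: "nat \<Rightarrow> nat \<Rightarrow> nat \<Rightarrow> 'a set \<Rightarrow> 'a set set \<Rightarrow> bool" where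
  "steiner_system t k v X \<B> \<longleftrightarrow>
     finite X \<and> card X = v \<and>
     (\<forall>B\<in>\<B>. B \<subseteq> X \<and> card B = k) \<and>
     (\<forall>T. T \<subseteq> X \<and> card T = t \<longrightarrow> (\<exists>!B. B \<in> \<B> \<and> T \<subseteq> B))"

definition steiner_quadruple_system :: "nat \<Rightarrow> 'a set \<Rightarrow> 'a set set \<Rightarrow> bool" where
  "steiner_quadruple_system v X \<B> \<longleftrightarrow> steiner_system 3 4 v X \<B>"

definition design_automorphism :: "'a set \<Rightarrow> 'a set set \<Rightarrow> ('a \<Rightarrow> 'a) \<Rightarrow> bool" where
  "design_automorphism X \<B> f \<longleftrightarrow> f permutes X \<and> (\<forall>B\<in>\<B>. f ` B \<in> \<B>)"

(* Being cyclic on X - {p} means that X - {p} is one full orbit of f, i.e. a single cycle,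
   whose length is then card (X - {p}) = v - 1. *)
definition rotational_sqs :: "nat \<Rightarrow> 'a set \<Rightarrow> 'a set set \<Rightarrow> bool" where
  "rotational_sqs v X \<B> \<longleftrightarrow>
     steiner_quadruple_system v X \<B> \<and>
     (\<exists>f. design_automorphism X \<B> f \<and> (\<exists>p\<in>X. f p = p \<and> cyclic_on f (X - {p})))"

end

theory Submission
  imports Defs
begin

text \<open>The points are the residues modulo 91 together with a fixed point \<open>\<infinity>\<close>, encoded as 91. The blocks are
  the translates of 345 base blocks, which in turn are generated from 75 starter blocks by the
  multiplier 4, of order 6 modulo 91; the starters were found by a computer search for an exact
  cover of the orbits of triples. As \<open>345 * 91 * 4 = 92 choose 3\<close>, it is enough that every triple is
  covered. Up to translation and exchanging two points, a triple is \<open>{0, b, c}\<close> with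
  \<open>1 \<le> b \<le> 45\<close>, so this is a finite check on the translates of base blocks that contain 0.\<close>

section \<open>Base blocks modulo 91 and the data of the finite check\<close>

definition shift :: "int \<Rightarrow> int \<Rightarrow> int" where
  "shift t x = (if x = 91 then 91 else (x + t) mod 91)"

definition scale :: "int \<Rightarrow> int \<Rightarrow> int" where
  "scale m x = (if x = 91 then 91 else m * x mod 91)"

text \<open>A starter is listed with the powers of 4 that map it to different orbits under translation; the
  orbits of some starters are invariant under \<open>64 = 4 ^ 3\<close>, \<open>16 = 4 ^ 2\<close> or 4.\<close>

definition starters :: "(int list \<times> int list list) list" where
  "starters =
    [([1, 4, 16, 64, 74, 23],
     [[0, 1, 2, 44], [0, 1, 3, 39], [0, 1, 4, 63], [0, 1, 5, 7], [0, 1, 8, 88], [0, 1, 9, 25],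
      [0, 1, 10, 82], [0, 1, 11, 36], [0, 1, 12, 72], [0, 1, 13, 50], [0, 1, 14, 89],
      [0, 1, 15, 41], [0, 1, 19, 49], [0, 1, 20, 35], [0, 1, 22, 59], [0, 1, 24, 66],
      [0, 1, 26, 70], [0, 1, 30, 51], [0, 1, 31, 77], [0, 1, 32, 55], [0, 1, 33, 37],
      [0, 1, 34, 46], [0, 1, 38, 53], [0, 1, 42, 79], [0, 1, 48, 80], [0, 1, 52, 61],
      [0, 1, 67, 81], [0, 1, 73, 86], [0, 2, 5, 40], [0, 2, 7, 85], [0, 2, 8, 14],
      [0, 2, 11, 30], [0, 2, 13, 55], [0, 2, 20, 79], [0, 2, 24, 82], [0, 2, 28, 81],
      [0, 2, 31, 80], [0, 2, 39, 60], [0, 2, 41, 50], [0, 2, 73, 84], [0, 3, 6, 44],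
      [0, 3, 12, 15], [0, 3, 13, 24], [0, 3, 36, 85], [0, 5, 20, 33], [0, 5, 36, 60]]),
     ([1, 4, 16],
     [[0, 1, 21, 85], [0, 1, 27, 28], [0, 1, 29, 56], [0, 2, 9, 63], [0, 2, 37, 65],
      [0, 2, 56, 67], [0, 3, 10, 52], [0, 3, 21, 31], [0, 3, 29, 84], [0, 3, 63, 73],
      [0, 5, 18, 49], [0, 7, 62, 91], [0, 14, 33, 91]]),
     ([1, 4],
     [[0, 1, 6, 17], [0, 1, 16, 74], [0, 1, 18, 76], [0, 1, 75, 91], [0, 2, 12, 34],
      [0, 2, 32, 57], [0, 2, 36, 61], [0, 2, 59, 91], [0, 3, 43, 76], [0, 3, 51, 91],
      [0, 5, 11, 66], [0, 5, 85, 91], [0, 7, 21, 63], [0, 7, 28, 42]]),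
     ([1],
     [[0, 13, 26, 52], [0, 13, 65, 91]])]"

definition orbit_blocks :: "int list \<Rightarrow> int list \<Rightarrow> int list list" where
  "orbit_blocks ms D = map (\<lambda>m. map (scale m) D) ms"

definition base_orbits :: "int list list list" where
  "base_orbits = concat (map (\<lambda>(ms, Ds). map (orbit_blocks ms) Ds) starters)"

definition base_blocks :: "int list list" where
  "base_blocks = concat base_orbits"

text \<open>These are the translates of \<open>D\<close> that contain 0, one for each point of
  \<open>D\<close> that a translation can move there.\<close>

definition normalized :: "int list \<Rightarrow> int list list" where
  "normalized D = map (\<lambda>p. map (shift (- p)) D) (filter (\<lambda>p. p \<noteq> 91) D)"

text \<open>The blocks are kept grouped by starter, and not in one long list, because the running time
  of \<open>code_simp\<close> is quadratic in the length of the lists it traverses.\<close>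

definition blocks_at_zero :: "int list list list" where
  "blocks_at_zero = map (\<lambda>Ds. concat (map normalized Ds)) base_orbits"

text \<open>The list \<open>[1..91]\<close> holds the candidates for the third point of a triple
  through 0, with 91 as the fixed point.\<close>

definition uncovered :: "int list list \<Rightarrow> int list" where
  "uncovered Ds = fold (\<lambda>D. filter (\<lambda>c. \<not> List.member D c)) Ds [1..91]"

definition blocks_through :: "int list list list \<Rightarrow> int \<Rightarrow> int list list" where
  "blocks_through Ess b = concat (map (filter (\<lambda>D. List.member D b)) Ess)"

definition all_covered :: "int list \<Rightarrow> int list list list \<Rightarrow> bool" where
  "all_covered bs Ess \<longleftrightarrow> list_all (\<lambda>b. uncovered (blocks_through Ess b) = []) bs"

section \<open>Counting criterion for Steiner systems\<close>

text \<open>A covering with at most as many blocks as a Steiner system needs has no room for a second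
  block through any \<open>t\<close>-subset.\<close>

lemma steiner_system_if_small_covering:
  assumes "finite X" "card X = v"
    and blocks: "\<And>B. B \<in> \<B> \<Longrightarrow> B \<subseteq> X \<and> card B = k"
    and covering: "\<And>T. T \<subseteq> X \<Longrightarrow> card T = t \<Longrightarrow> \<exists>B\<in>\<B>. T \<subseteq> B"
    and few: "card \<B> * (k choose t) \<le> v choose t"
  shows "steiner_system t k v X \<B>"
proof -
  define subs where "subs B = {T. T \<subseteq> B \<and> card T = t}" for B :: "'a set"
  have fin: "finite \<B>"
    using assms(1) blocks by (intro finite_subset[of \<B> "Pow X"]) auto
  have finB: "finite B" if "B \<in> \<B>" for B
    using that blocks assms(1) finite_subset by blast
  have card_subs: "card (subs B) = (k choose t)" "finite (subs B)" if "B \<in> \<B>" for B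
    using n_subsets[OF finB[OF that]] blocks[OF that] finB[OF that] by (auto simp: subs_def)
  have "B1 = B2" if T: "T \<subseteq> X" "card T = t" "B1 \<in> \<B>" "T \<subseteq> B1" "B2 \<in> \<B>" "T \<subseteq> B2" for T B1 B2
  proof (rule ccontr)
    assume "B1 \<noteq> B2"
    have T1: "T \<in> subs B1"
      using T by (auto simp: subs_def)
    \<comment> \<open>Since \<open>B2\<close> already accounts for \<open>T\<close>, dropping
      \<open>T\<close> from \<open>subs B1\<close> still leaves a cover of \<open>subs X\<close>.
      This saves one in a count that has nothing to spare.\<close>
    have "subs X \<subseteq> (\<Union>B\<in>\<B> - {B1}. subs B) \<union> (subs B1 - {T})" (is "_ \<subseteq> ?U \<union> ?V")
    proof
      fix S
      assume "S \<in> subs X"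
      then obtain B where "B \<in> \<B>" "S \<in> subs B"
        using covering[of S] by (auto simp: subs_def)
      moreover have "T \<in> subs B2" "B2 \<in> \<B> - {B1}"
        using T \<open>B1 \<noteq> B2\<close> by (auto simp: subs_def)
      ultimately show "S \<in> ?U \<union> ?V"
        by (cases "B = B1"; cases "S = T") blast+
    qed
    moreover have "finite (?U \<union> ?V)"
      using fin card_subs T by auto
    ultimately have "card (subs X) \<le> card ?U + card ?V"
      by (rule order_trans[OF card_mono card_Un_le, rotated])
    moreover have "card (subs X) = (v choose t)"
      using n_subsets[OF assms(1)] assms(2) by (simp add: subs_def)
    moreover have "card ?U \<le> (\<Sum>B\<in>\<B> - {B1}. card (subs B))"
      using fin by (intro card_UN_le) auto
    moreover have "(\<Sum>B\<in>\<B> - {B1}. card (subs B)) = (card \<B> - 1) * (k choose t)"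
      using card_subs fin T by simp
    moreover have "card ?V < card (subs B1)"
      using card_subs T T1 by (intro card_Diff1_less) auto
    moreover have "card \<B> = Suc (card \<B> - 1)"
      using fin T by (metis card_gt_0_iff Suc_pred' empty_iff)
    then have "card \<B> * (k choose t) = (card \<B> - 1) * (k choose t) + (k choose t)"
      by (metis add.commute mult_Suc)
    ultimately show False
      using few card_subs(1)[OF T(3)] by linarith
  qed
  then show ?thesis
    using assms(1,2) blocks covering unfolding steiner_system_def by metis
qed

section \<open>Evaluation of the finite check\<close>

lemma mem_uncovered_iff: "c \<in> set (uncovered Ds) \<longleftrightarrow> c \<in> {1..91} \<and> (\<forall>D\<in>set Ds. c \<notin> set D)"
proof -
  have "c \<in> set (fold (\<lambda>D. filter (\<lambda>c. \<not> List.member D c)) Ds R) \<longleftrightarrow>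
      c \<in> set R \<and> (\<forall>D\<in>set Ds. c \<notin> set D)" for R
    by (induction Ds arbitrary: R) auto
  then show ?thesis
    by (simp add: uncovered_def)
qed

lemma all_covered_blocks_at_zero: "all_covered [1..45] blocks_at_zero"
  by code_simp

lemma base_blocks_wf:
  "list_all (\<lambda>D. length D = 4 \<and> distinct D \<and> list_all (\<lambda>x. 0 \<le> x \<and> x \<le> 91) D) base_blocks"
  by code_simp

lemma length_base_blocks: "length base_blocks = 345"
  by code_simp

lemma base_block:
  assumes "D \<in> set base_blocks"
  shows "card (set D) = 4" "set D \<subseteq> {0..91}"
  using assms base_blocks_wf by (auto simp: list_all_iff distinct_card)

section \<open>From the check to all triples\<close>

lemma shift_shift: "shift s (shift t x) = shift ((s + t) mod 91) x"
proof -
  \<comment> \<open>A shifted residue is never mistaken for the fixed point.\<close>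
  have "(x + t) mod 91 \<noteq> 91"
    using pos_mod_bound[of 91 "x + t"] by linarith
  then show ?thesis
    by (simp add: shift_def mod_simps ac_simps)
qed

lemma shift_0: "x \<in> {0..91} \<Longrightarrow> shift 0 x = x"
  by (simp add: shift_def)

lemma shift_in: "shift t x \<in> {0..91}"
  by (simp add: shift_def order_less_imp_le)

lemma inj_on_shift: "inj_on (shift t) {0..91}"
proof (rule inj_on_inverseI)
  fix x :: int
  assume "x \<in> {0..91}"
  then show "shift (- t) (shift t x) = x"
    by (simp add: shift_shift shift_0)
qed

text \<open>Reads the evaluated check as a statement on base blocks: the block found through 0,
  \<open>b\<close> and \<open>c\<close> is a translate of \<open>D\<close>, and \<open>p\<close> is
  the point moved to 0.\<close>

lemma pair_covered:
  assumes "b \<in> {1..45}" "c \<in> {1..91}"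
  obtains D p where "D \<in> set base_blocks" "p \<in> set D" "p \<noteq> 91" "{b, c} \<subseteq> shift (- p) ` set D"
proof -
  have "c \<notin> set (uncovered (blocks_through blocks_at_zero b))"
    using all_covered_blocks_at_zero assms by (simp add: all_covered_def list_all_iff)
  then obtain E where E: "E \<in> set (blocks_through blocks_at_zero b)" "c \<in> set E"
    using assms by (auto simp: mem_uncovered_iff)
  then obtain Ds D where "Ds \<in> set base_orbits" "D \<in> set Ds" "E \<in> set (normalized D)" "b \<in> set E"
    by (auto simp: blocks_through_def blocks_at_zero_def)
  then obtain p where "D \<in> set base_blocks" "p \<in> set D" "p \<noteq> 91" "E = map (shift (- p)) D"
    unfolding base_blocks_def normalized_def by auto
  with E(2) \<open>b \<in> set E\<close> show thesis
    by (intro that[of D p]) auto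
qed

text \<open>Translation by \<open>- a\<close> sends \<open>a\<close> to 0 and \<open>b\<close> into
  the checked range, while \<open>c\<close> avoids 0 because it differs from
  \<open>a\<close>.\<close>

lemma near_triple_covered:
  assumes "a \<in> {0..<91}" "b \<in> {0..<91}" "c \<in> {0..91}" "c \<noteq> a" "(b - a) mod 91 \<in> {1..45}"
  shows "\<exists>t\<in>{0..<91}. \<exists>D\<in>set base_blocks. {a, b, c} \<subseteq> shift t ` set D"
proof -
  have "shift (- a) b \<in> {1..45}"
    using assms by (auto simp: shift_def)
  moreover have "shift (- a) c \<in> {1..91}"
  proof (cases "c = 91")
    case False
    then have "c mod 91 \<noteq> a mod 91"
      using assms by simp
    then have "(c - a) mod 91 \<noteq> 0"
      by (simp add: mod_eq_dvd_iff mod_eq_0_iff_dvd)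
    moreover have "0 \<le> (c - a) mod 91" "(c - a) mod 91 < 91"
      by simp_all
    ultimately have "(c - a) mod 91 \<in> {1..91}"
      unfolding atLeastAtMost_iff by linarith
    with False show ?thesis
      by (simp add: shift_def)
  qed (simp add: shift_def)
  ultimately obtain D p where D: "D \<in> set base_blocks" "p \<in> set D" "p \<noteq> 91"
      "{shift (- a) b, shift (- a) c} \<subseteq> shift (- p) ` set D"
    by (rule pair_covered)
  then obtain y z where yz: "y \<in> set D" "z \<in> set D"
      "shift (- a) b = shift (- p) y" "shift (- a) c = shift (- p) z"
    by auto
  \<comment> \<open>The base block is moved by \<open>- p\<close> to meet 0 and then back by
    \<open>a\<close>.\<close>
  let ?t = "(a - p) mod 91"
  have *: "x = shift ?t w" if "shift (- a) x = shift (- p) w" "x \<in> {0..91}" for x w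
  proof -
    have "x = shift a (shift (- a) x)"
      using that(2) by (simp add: shift_shift shift_0)
    also have "\<dots> = shift ?t w"
      by (simp add: that(1) shift_shift)
    finally show ?thesis .
  qed
  have "a = shift ?t p" "b = shift ?t y" "c = shift ?t z"
    using assms D yz by (auto intro!: *) (auto simp: shift_def)
  then have "{a, b, c} \<subseteq> shift ?t ` set D"
    using D yz by blast
  moreover have "?t \<in> {0..<91}"
    by simp
  ultimately show ?thesis
    using D(1) by blast
qed

text \<open>The residues of \<open>b - a\<close> and \<open>a - b\<close> are nonzero and sum to 91,
  so one of them is at most 45; \<open>a\<close> and \<open>b\<close> are exchanged if
  necessary.\<close>

lemma triple_covered:
  assumes "a \<in> {0..<91}" "b \<in> {0..<91}" "c \<in> {0..91}" "a \<noteq> b" "c \<noteq> a" "c \<noteq> b"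
  shows "\<exists>t\<in>{0..<91}. \<exists>D\<in>set base_blocks. {a, b, c} \<subseteq> shift t ` set D"
proof -
  have "(b - a) mod 91 = (if a \<le> b then b - a else b - a + 91)"
    and "(a - b) mod 91 = (if b \<le> a then a - b else a - b + 91)"
    using assms mod_pos_pos_trivial[of "b - a" 91] mod_pos_pos_trivial[of "b - a + 91" 91]
      mod_pos_pos_trivial[of "a - b" 91] mod_pos_pos_trivial[of "a - b + 91" 91] by auto
  then have "(b - a) mod 91 \<in> {1..45} \<or> (a - b) mod 91 \<in> {1..45}"
    using assms by auto
  then show ?thesis
    using near_triple_covered[of a b c] near_triple_covered[of b a c] assms
    by (auto simp: insert_commute)
qed

section \<open>The Steiner system on 92 points\<close>

definition block :: "int \<Rightarrow> int list \<Rightarrow> nat set" where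
  "block t D = nat ` shift t ` set D"

definition blocks :: "nat set set" where
  "blocks = (\<lambda>(t, D). block t D) ` ({0..<91} \<times> set base_blocks)"

lemma steiner_blocks: "steiner_system 3 4 92 {..91} blocks"
proof (rule steiner_system_if_small_covering)
  fix B
  assume "B \<in> blocks"
  then obtain t D where D: "D \<in> set base_blocks" and B: "B = block t D"
    by (auto simp: blocks_def)
  have "inj_on nat (shift t ` set D)"
    using shift_in by (intro inj_onI) (metis atLeastAtMost_iff eq_nat_nat_iff imageE)
  then have "card B = card (set D)"
    using base_block(2)[OF D] by (simp add: B block_def card_image inj_on_subset[OF inj_on_shift])
  moreover have "B \<subseteq> {..91}"
    using shift_in by (auto simp: B block_def nat_le_iff)
  ultimately show "B \<subseteq> {..91} \<and> card B = 4"
    using base_block(1)[OF D] by simp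
next
  fix T :: "nat set"
  assume T: "T \<subseteq> {..91}" "card T = 3"
  then obtain x y z where xyz: "T = {x, y, z}" "x \<noteq> y" "x \<noteq> z" "y \<noteq> z"
    by (auto simp: card_3_iff)
  \<comment> \<open>At most one of the three points is 91; it is placed last, where
    \<open>triple_covered\<close> admits it.\<close>
  obtain a b c where abc: "T = {a, b, c}" "a < 91" "b < 91" "c \<le> 91" "a \<noteq> b" "c \<noteq> a" "c \<noteq> b"
  proof -
    consider "x = 91" | "y = 91" | "x < 91" "y < 91"
      using T(1) xyz(1) by fastforce
    then show thesis
    proof cases
      case 1
      with T(1) xyz show thesis
        by (intro that[of y z x]) auto
    next
      case 2
      with T(1) xyz show thesis
        by (intro that[of x z y]) auto
    next
      case 3
      with T(1) xyz show thesis
        by (intro that[of x y z]) auto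
    qed
  qed
  obtain t D where "t \<in> {0..<91}" "D \<in> set base_blocks" "{int a, int b, int c} \<subseteq> shift t ` set D"
    using triple_covered[of "int a" "int b" "int c"] abc by auto
  moreover from this(3) have "nat ` {int a, int b, int c} \<subseteq> block t D"
    unfolding block_def by (rule image_mono)
  ultimately show "\<exists>B\<in>blocks. T \<subseteq> B"
    unfolding blocks_def by (force simp: abc(1))
next
  show "finite {..91 :: nat}" "card {..91 :: nat} = 92"
    by simp_all
next
  \<comment> \<open>Coinciding translates could only lower the count, so an upper bound
    suffices.\<close>
  have "card blocks \<le> card ({0..<91::int} \<times> set base_blocks)"
    unfolding blocks_def by (intro card_image_le) simp
  also have "\<dots> \<le> 91 * 345"
    using card_length[of base_blocks] by (simp add: length_base_blocks card_cartesian_product)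
  finally show "card blocks * (4 choose 3) \<le> 92 choose 3"
    by (simp add: binomial_fact' fact_numeral)
qed

section \<open>The automorphism of order 91\<close>

definition rotation :: "nat \<Rightarrow> nat" where
  "rotation n = (if n < 91 then (n + 1) mod 91 else n)"

text \<open>Adding 1 to every residue only advances the translation index, which is why
  \<open>blocks\<close> is invariant.\<close>

lemma rotation_block: "rotation ` block t D = block ((t + 1) mod 91) D"
proof -
  have "rotation (nat (shift t x)) = nat (shift ((t + 1) mod 91) x)" for x
  proof (cases "x = 91")
    case False
    have "(x + t) mod 91 < 91" "0 \<le> (x + t) mod 91"
      by simp_all
    then have "rotation (nat (shift t x)) = nat (((x + t) mod 91 + 1) mod 91)"
      using False by (simp add: rotation_def shift_def nat_mod_distrib nat_add_distrib)
    then show ?thesis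
      using False by (simp add: shift_def mod_simps ac_simps)
  qed (simp add: shift_def rotation_def)
  then show ?thesis
    by (simp add: block_def image_image)
qed

lemma rotation_permutes: "rotation permutes {..91}"
proof (rule permutes_subset)
  have "inj_on rotation {..<91}"
  proof (rule inj_onI)
    fix m n
    assume "m \<in> {..<91}" "n \<in> {..<91}" "rotation m = rotation n"
    then show "m = n"
      by (auto simp: rotation_def mod_Suc split: if_splits)
  qed
  moreover have "rotation ` {..<91} \<subseteq> {..<91}"
    by (auto simp: rotation_def)
  ultimately have "bij_betw rotation {..<91} {..<91}"
    by (simp add: bij_betw_def endo_inj_surj)
  then show "rotation permutes {..<91}"
    by (rule bij_imp_permutes) (simp add: rotation_def)
qed auto

lemma rotation_cyclic: "cyclic_on rotation {..<91}"
proof -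
  have pow: "(rotation ^^ n) 0 = n mod 91" for n
    by (induction n) (simp_all add: rotation_def mod_simps)
  have "{..<91} = {(rotation ^^ n) 0 | n. 0 < n}"
  proof (intro equalityI subsetI)
    fix m :: nat
    assume "m \<in> {..<91}"
    \<comment> \<open>An orbit consists of positive iterates, so 91 is added to the exponent to
      reach 0 as well.\<close>
    then have "m = (rotation ^^ (m + 91)) 0" "0 < m + 91"
      unfolding pow by simp_all
    then show "m \<in> {(rotation ^^ n) 0 | n. 0 < n}"
      by blast
  qed (auto simp: pow)
  then have "{..<91} = orbit rotation 0"
    by (simp only: orbit_altdef)
  then show ?thesis
    by (rule cyclic_on_singleI[rotated]) simp
qed

theorem theorem2:
  shows "\<exists>(X :: nat set) \<B>. rotational_sqs 92 X \<B>"
proof -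
  have "rotation ` B \<in> blocks" if "B \<in> blocks" for B
    using that by (force simp: blocks_def rotation_block)
  then have "design_automorphism {..91} blocks rotation"
    by (simp add: design_automorphism_def rotation_permutes)
  moreover have "{..91} - {91 :: nat} = {..<91}"
    by auto
  then have "cyclic_on rotation ({..91} - {91})"
    using rotation_cyclic by simp
  moreover have "rotation 91 = 91"
    by (simp add: rotation_def)
  ultimately show ?thesis
    using steiner_blocks unfolding rotational_sqs_def steiner_quadruple_system_def by (metis atMost_iff order_refl)
qed

end
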